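(* Let $\mathscr{A}$ be a Banach algebra which admits a non-trivial multiplicative linear functional $\varphi \in \mathscr{A}^*$. Let $n \ge 1$ and $a = (a_1,\dotsc,a_n)$, $b = (b_1,\dotsc,b_n) \in \mathscr{A}^n$. Then the elementary operator $\mathcal{E}_{a,b} \colon \mathscr{A} \to \mathscr{A}$, $\mathcal{E}_{a,b}(s) = \sum_{j=1}^n a_j s b_j$, is not hypercyclic.
   Context: A multiplicative linear functional is a nonzero linear functional $\varphi \colon \mathscr{A} \to \mathbb{C}$ such that $\varphi(ab) = \varphi(a)\varphi(b)$ for all $a,b \in \mathscr{A}$. The Banach algebra is not assumed to be unital. An operator $U$ on a Banach space $Y$ is hypercyclic if there is $y \in Y$ whose orbit $\{U^n y : n \ge 0\}$ is dense in $Y$. *)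

theory Defs
  imports "HOL-Analysis.Analysis"
begin

text \<open>
  The distribution has real normed algebras only, so the complex scalar action is added on top of
  the real structure, of which it is required to be an extension.
\<close>

class complex_vector = real_vector +
  fixes scaleC :: "complex \<Rightarrow> 'a \<Rightarrow> 'a" (infixr \<open>*\<^sub>C\<close> 75)
  assumes scaleC_add_right: "c *\<^sub>C (x + y) = c *\<^sub>C x + c *\<^sub>C y"
    and scaleC_add_left: "(c + d) *\<^sub>C x = c *\<^sub>C x + d *\<^sub>C x"
    and scaleC_scaleC: "c *\<^sub>C (d *\<^sub>C x) = (c * d) *\<^sub>C x"
    and scaleC_one: "1 *\<^sub>C x = x"
    and scaleR_scaleC: "r *\<^sub>R x = complex_of_real r *\<^sub>C x"

class complex_normed_vector = complex_vector + real_normed_vector +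
  assumes norm_scaleC: "norm (c *\<^sub>C x) = cmod c * norm x"

text \<open>
  As in \<^class>\<open>real_normed_algebra\<close>, multiplication is associative and the norm submultiplicative;
  no unit is assumed. A complex Banach algebra is a type of sort
  \<open>{complex_normed_algebra, banach}\<close>.
\<close>

class complex_normed_algebra = complex_normed_vector + real_normed_algebra +
  assumes mult_scaleC_left: "(c *\<^sub>C x) * y = c *\<^sub>C (x * y)"
    and mult_scaleC_right: "x * (c *\<^sub>C y) = c *\<^sub>C (x * y)"

interpretation complex_vector: vector_space "scaleC :: complex \<Rightarrow> 'a \<Rightarrow> 'a::complex_vector"
  by unfold_locales (simp_all add: scaleC_add_right scaleC_add_left scaleC_scaleC scaleC_one)

instantiation complex :: complex_normed_algebra
begin

definition scaleC_complex :: "complex \<Rightarrow> complex \<Rightarrow> complex"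
  where "scaleC_complex c x = c * x"

instance
  by standard (simp_all add: scaleC_complex_def algebra_simps norm_mult scaleR_conv_of_real)

end

abbreviation clinear :: "('a::complex_vector \<Rightarrow> 'b::complex_vector) \<Rightarrow> bool"
  where "clinear \<equiv> Vector_Spaces.linear scaleC scaleC"

definition topological_dual :: "('a::complex_normed_vector \<Rightarrow> complex) set"
  where "topological_dual = {\<phi>. clinear \<phi> \<and> (\<exists>K. \<forall>x. cmod (\<phi> x) \<le> K * norm x)}"

definition multiplicative_linear_functional :: "('a::complex_normed_algebra \<Rightarrow> complex) \<Rightarrow> bool"
  where "multiplicative_linear_functional \<phi> \<longleftrightarrow>
    clinear \<phi> \<and> (\<exists>x. \<phi> x \<noteq> 0) \<and> (\<forall>x y. \<phi> (x * y) = \<phi> x * \<phi> y)"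

text \<open>Tuples in \<open>A\<^sup>n\<close> are functions on \<open>nat\<close>, of which only the values at \<open>1, \<dots>, n\<close> matter.\<close>

definition elementary_operator ::
    "nat \<Rightarrow> (nat \<Rightarrow> 'a::complex_normed_algebra) \<Rightarrow> (nat \<Rightarrow> 'a) \<Rightarrow> 'a \<Rightarrow> 'a"
  where "elementary_operator n a b s = (\<Sum>j=1..n. a j * s * b j)"

definition hypercyclic :: "('a::complex_normed_vector \<Rightarrow> 'a) \<Rightarrow> bool"
  where "hypercyclic U \<longleftrightarrow> (\<exists>y. closure (range (\<lambda>n. (U ^^ n) y)) = UNIV)"

end

theory Submission
  imports Defs
begin

text \<open>
  Applying \<open>\<phi>\<close> to the elementary operator turns it into a scalar: multiplicativity gives
  \<open>\<phi> (\<Sum>j. a\<^sub>j s b\<^sub>j) = c * \<phi> s\<close> with \<open>c = (\<Sum>j. \<phi> a\<^sub>j * \<phi> b\<^sub>j)\<close>. Thus \<open>\<phi>\<close> is a continuous surjection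
  that intertwines the elementary operator with multiplication by \<open>c\<close> on the complex plane, and
  it would carry a dense orbit of the former to a dense orbit of the latter
  (\<open>hypercyclic_semiconjugate\<close>). But the moduli along an orbit of multiplication by \<open>c\<close> are
  monotone, so the orbit is either bounded or bounded away from \<open>0\<close>
  (\<open>not_hypercyclic_complex_mult\<close>).
\<close>

text \<open>
  The intertwining relation makes \<open>f\<close> send the orbit of \<open>y\<close> onto the orbit of \<open>f y\<close>, and a
  continuous surjection maps dense sets to dense sets.
\<close>

lemma hypercyclic_semiconjugate:
  fixes U :: "'a::complex_normed_vector \<Rightarrow> 'a" and V :: "'b::complex_normed_vector \<Rightarrow> 'b"
  assumes "hypercyclic U" and cont: "continuous_on UNIV f" and "surj f"
    and intertwine: "\<And>x. f (U x) = V (f x)"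
  shows "hypercyclic V"
proof -
  obtain y where y: "closure (range (\<lambda>k. (U ^^ k) y)) = UNIV"
    using assms(1) unfolding hypercyclic_def by blast
  have iterate: "f ((U ^^ k) y) = (V ^^ k) (f y)" for k
    by (induction k) (simp_all add: intertwine)
  have "f ` closure (range (\<lambda>k. (U ^^ k) y)) \<subseteq> closure (range (\<lambda>k. (V ^^ k) (f y)))"
  proof (rule image_closure_subset)
    show "f ` range (\<lambda>k. (U ^^ k) y) \<subseteq> closure (range (\<lambda>k. (V ^^ k) (f y)))"
      using closure_subset[of "range (\<lambda>k. (V ^^ k) (f y))"] by (auto simp: iterate)
  qed (use cont y in auto)
  then have "closure (range (\<lambda>k. (V ^^ k) (f y))) = UNIV"
    using \<open>surj f\<close> y by auto
  then show ?thesis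
    unfolding hypercyclic_def by blast
qed

text \<open>
  Since \<open>\<bar>c\<^sup>k z\<bar> = \<bar>c\<bar>\<^sup>k \<bar>z\<bar>\<close>, the orbit of \<open>z\<close> stays in the closed disc of radius \<open>\<bar>z\<bar>\<close> when
  \<open>\<bar>c\<bar> \<le> 1\<close> and outside the open one when \<open>\<bar>c\<bar> > 1\<close>. The orbit of \<open>0\<close>, for which the open disc
  is empty, belongs with the bounded ones.
\<close>

lemma not_hypercyclic_complex_mult:
  fixes c :: complex
  shows "\<not> hypercyclic ((*) c)"
proof
  assume "hypercyclic ((*) c)"
  then obtain z where z: "closure (range (\<lambda>k. ((*) c ^^ k) z)) = UNIV"
    unfolding hypercyclic_def by blast
  have orbit: "((*) c ^^ k) z = c ^ k * z" for k
    by (induction k) simp_all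
  show False
  proof (cases "cmod c \<le> 1 \<or> z = 0")
    case True
    then have "range (\<lambda>k. ((*) c ^^ k) z) \<subseteq> cball 0 (cmod z)"
      by (auto simp: orbit norm_mult norm_power power_le_one mult_left_le_one_le)
    then have "UNIV \<subseteq> cball (0 :: complex) (cmod z)"
      using closure_minimal[OF _ closed_cball] z by metis
    then have "complex_of_real (cmod z + 1) \<in> cball 0 (cmod z)"
      by blast
    then show False
      by (simp del: of_real_add)
  next
    case False
    then have "cmod z \<le> cmod c ^ k * cmod z" for k
      by (simp add: one_le_power mult_le_cancel_right1)
    then have "range (\<lambda>k. ((*) c ^^ k) z) \<subseteq> - ball 0 (cmod z)"
      by (auto simp: orbit norm_mult norm_power simp flip: not_le)
    then have "UNIV \<subseteq> - ball (0 :: complex) (cmod z)"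
      using closure_minimal[of _ "- ball (0 :: complex) (cmod z)"] z
      by (metis closed_Compl open_ball)
    then have "(0 :: complex) \<notin> ball 0 (cmod z)"
      by blast
    then show False
      using False by simp
  qed
qed

lemma topological_dual_continuous_on:
  assumes "\<phi> \<in> topological_dual"
  shows "continuous_on S \<phi>"
proof -
  obtain K where lin: "clinear \<phi>" and K: "\<And>x. cmod (\<phi> x) \<le> K * norm x"
    using assms unfolding topological_dual_def by blast
  interpret \<phi>: Vector_Spaces.linear scaleC scaleC \<phi>
    by (rule lin)
  have "bounded_linear \<phi>"
  proof (rule bounded_linear_intro)
    show "cmod (\<phi> x) \<le> norm x * K" for x
      using K[of x] by (simp add: mult.commute)
  qed (simp_all add: \<phi>.add \<phi>.scale scaleR_scaleC)
  then show ?thesis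
    by (rule linear_continuous_on)
qed

lemma clinear_functional_surj:
  assumes "clinear \<phi>" and "\<phi> x \<noteq> (0 :: complex)"
  shows "surj \<phi>"
proof (rule surjI)
  interpret \<phi>: Vector_Spaces.linear scaleC scaleC \<phi>
    by (rule assms(1))
  show "\<phi> ((w / \<phi> x) *\<^sub>C x) = w" for w
    using assms(2) by (simp add: \<phi>.scale scaleC_complex_def)
qed

theorem theorem5p1:
  fixes \<phi> :: "'a::{complex_normed_algebra, banach} \<Rightarrow> complex"
    and n :: nat
    and a b :: "nat \<Rightarrow> 'a"
  assumes "multiplicative_linear_functional \<phi>"
    and "\<phi> \<in> topological_dual"
    and "n \<ge> 1"
  shows "\<not> hypercyclic (elementary_operator n a b)"
proof
  assume hyp: "hypercyclic (elementary_operator n a b)"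
  obtain x where lin: "clinear \<phi>" and x: "\<phi> x \<noteq> 0" and mult: "\<And>x y. \<phi> (x * y) = \<phi> x * \<phi> y"
    using assms(1) unfolding multiplicative_linear_functional_def by blast
  interpret \<phi>: Vector_Spaces.linear scaleC scaleC \<phi>
    by (rule lin)
  define c where "c = (\<Sum>j=1..n. \<phi> (a j) * \<phi> (b j))"
  have "\<phi> (elementary_operator n a b s) = c * \<phi> s" for s
    by (simp add: elementary_operator_def c_def \<phi>.sum mult sum_distrib_left mult_ac)
  then have "hypercyclic ((*) c)"
    using hypercyclic_semiconjugate[OF hyp topological_dual_continuous_on[OF assms(2)]
        clinear_functional_surj[OF lin x]] by blast
  then show False
    using not_hypercyclic_complex_mult by blast
qed

end
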